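(* Let $X$ be a finite set of size $v$ and $1\le t\le s$. If there is a $(t,s,v)$-AONT, then there is an OA$(t,s,v)$.
   Context: A $(t,s,v)$-all-or-nothing transform (AONT) over an alphabet $X$ with $|X|=v$ is a bijection $\phi: X^s\to X^s$ such that for every $I\subseteq\{1,\dots,s\}$ with $|I|=t$ and every $J\subseteq\{1,\dots,s\}$ with $|J|=t$, the values of the inputs $x_i$ ($i\in I$) are completely undetermined given the outputs $y_j$ ($j\notin J$), where $\mathbf{y}=\phi(\mathbf{x})$; combinatorially, for every $\mathbf{a}\in X^{I}$ and every $\mathbf{b}\in X^{\{1,\dots,s\}\setminus J}$ there is exactly one $\mathbf{x}\in X^s$ with $\mathbf{x}|_I=\mathbf{a}$ and $\phi(\mathbf{x})|_{\{1,\dots,s\}\setminus J}=\mathbf{b}$. An OA$(t,k,v)$ (orthogonal array) is a $v^t\times k$ array with entries from a $v$-set such that in any $t$ columns every $t$-tuple of symbols occurs in exactly one row. *)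

theory Defs
  imports Main "HOL-Library.FuncSet"
begin

(* X^s is the set of extensional functions {1..s} \<rightarrow>\<^sub>E X.  For a set D of coordinates,
   X^D is D \<rightarrow>\<^sub>E X and x|_D is restrict x D. *)

definition is_AONT :: "nat \<Rightarrow> nat \<Rightarrow> nat \<Rightarrow> 'a set \<Rightarrow> ((nat \<Rightarrow> 'a) \<Rightarrow> (nat \<Rightarrow> 'a)) \<Rightarrow> bool" where
  "is_AONT t s v X \<phi> \<longleftrightarrow>
     finite X \<and> card X = v \<and>
     bij_betw \<phi> ({1..s} \<rightarrow>\<^sub>E X) ({1..s} \<rightarrow>\<^sub>E X) \<and>
     (\<forall>I J. I \<subseteq> {1..s} \<and> card I = t \<and> J \<subseteq> {1..s} \<and> card J = t \<longrightarrow>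
        (\<forall>a \<in> I \<rightarrow>\<^sub>E X. \<forall>b \<in> ({1..s} - J) \<rightarrow>\<^sub>E X.
           \<exists>!x. x \<in> {1..s} \<rightarrow>\<^sub>E X \<and> restrict x I = a \<and> restrict (\<phi> x) ({1..s} - J) = b))"

(* A r c is the entry in row r and column c; rows are numbered 0, ..., v^t - 1 and columns
   1, ..., k.  Values of A outside this range are irrelevant, and rows may repeat unless
   the last condition excludes it. *)

definition is_OA :: "nat \<Rightarrow> nat \<Rightarrow> nat \<Rightarrow> (nat \<Rightarrow> nat \<Rightarrow> 'a) \<Rightarrow> bool" where
  "is_OA t k v A \<longleftrightarrow>
     (\<exists>S. finite S \<and> card S = v \<and>
        (\<forall>r < v ^ t. \<forall>c \<in> {1..k}. A r c \<in> S) \<and>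
        (\<forall>C. C \<subseteq> {1..k} \<and> card C = t \<longrightarrow>
           (\<forall>u \<in> C \<rightarrow>\<^sub>E S. \<exists>!r. r < v ^ t \<and> restrict (A r) C = u)))"

end

theory Submission
  imports Defs
begin

text \<open>The rows of the orthogonal array are the inputs whose outputs outside a fixed set of t
  coordinates take prescribed values: in any t input coordinates, each t-tuple then occurs exactly
  once.\<close>

theorem theorem22:
  fixes X :: "'a set" and t s v :: nat
  assumes "finite X" and "card X = v"
    and "1 \<le> t" and "t \<le> s"
    and "\<exists>\<phi>. is_AONT t s v X \<phi>"
  shows "\<exists>A :: nat \<Rightarrow> nat \<Rightarrow> 'a. is_OA t s v A"
\<comment> \<open>Prescribing output values needs a nonempty alphabet, so the empty one is treated
  apart: as \<open>t\<close> is positive, there are \<open>0 ^ t = 0\<close> rows and no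
  \<open>t\<close>-tuples to cover, and any array works.\<close>
proof (cases "X = {}")
  case True
  then have no_rows: "\<not> r < v ^ t" for r using assms(2,3) by (simp add: zero_power)
  have "C \<rightarrow>\<^sub>E X = {}" if "card C = t" for C :: "nat set"
  proof -
    have "C \<noteq> {}" using that assms(3) by auto
    then show ?thesis using True by (auto simp: PiE_eq_empty_iff)
  qed
  then have "is_OA t s v (\<lambda>r c. undefined :: 'a)"
    unfolding is_OA_def using assms(1,2) no_rows by (intro exI[of _ X]) simp
  then show ?thesis by blast
next
  case False
  obtain \<phi> where \<phi>: "is_AONT t s v X \<phi>" using assms(5) by blast
  \<comment> \<open>Any \<open>t\<close>-subset of \<open>{1..s}\<close> would serve as the set of
    unprescribed outputs.\<close>
  define J where "J = {1..t}"
  have J: "J \<subseteq> {1..s}" "card J = t" using assms(4) by (auto simp: J_def)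
  obtain b where b: "b \<in> ({1..s} - J) \<rightarrow>\<^sub>E X"
    using False by (metis PiE_eq_empty_iff ex_in_conv)
  define R where "R = {x \<in> {1..s} \<rightarrow>\<^sub>E X. restrict (\<phi> x) ({1..s} - J) = b}"
  \<comment> \<open>This is the AONT condition with \<open>J\<close> and \<open>b\<close> held fixed
    while \<open>I\<close> ranges over all \<open>t\<close>-sets of inputs.\<close>
  have ex1: "\<exists>!x. x \<in> R \<and> restrict x I = a"
    if "I \<subseteq> {1..s}" "card I = t" "a \<in> I \<rightarrow>\<^sub>E X" for I a
  proof -
    have "\<exists>!x. x \<in> {1..s} \<rightarrow>\<^sub>E X \<and> restrict x I = a \<and> restrict (\<phi> x) ({1..s} - J) = b"
      using \<phi>[unfolded is_AONT_def, THEN conjunct2, THEN conjunct2, THEN conjunct2,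
        rule_format, of I J a b] that J b by simp
    then show ?thesis unfolding R_def by (simp add: conj_ac)
  qed
  \<comment> \<open>To count \<open>R\<close>, the set \<open>J\<close> is used a second time, now
    as a set of input coordinates: \<open>ex1\<close> with \<open>I = J\<close> matches
    \<open>R\<close> with the \<open>t\<close>-tuples over \<open>X\<close>.\<close>
  have "bij_betw (\<lambda>x. restrict x J) R (J \<rightarrow>\<^sub>E X)"
  proof (rule bij_betwI')
    have maps: "restrict x J \<in> J \<rightarrow>\<^sub>E X" if "x \<in> R" for x
      using that J(1) unfolding R_def by (auto dest: PiE_mem)
    show "restrict x J \<in> J \<rightarrow>\<^sub>E X" if "x \<in> R" for x
      by (rule maps[OF that])
    show "(restrict x J = restrict y J) = (x = y)" if "x \<in> R" "y \<in> R" for x y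
      using ex1[OF J maps[OF that(1)]] that by auto
    show "\<exists>x\<in>R. a = restrict x J" if "a \<in> J \<rightarrow>\<^sub>E X" for a
      using ex1[OF J that] by auto
  qed
  then have "card R = v ^ t"
    using assms(2) J(2) by (simp add: bij_betw_same_card card_PiE J_def)
  moreover have "finite R"
    unfolding R_def using assms(1) by (simp add: finite_PiE)
  \<comment> \<open>Numbering the elements of \<open>R\<close> gives the array: row \<open>r\<close>
    is the input vector \<open>A r\<close> itself.\<close>
  ultimately obtain A where A: "bij_betw A {0..<v ^ t} R"
    using ex_bij_betw_nat_finite by metis
  have "A r c \<in> X" if "r < v ^ t" "c \<in> {1..s}" for r c
  proof -
    have "A r \<in> {1..s} \<rightarrow>\<^sub>E X"
      using bij_betwE[OF A] that(1) unfolding R_def by simp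
    then show ?thesis using that(2) by (rule PiE_mem)
  qed
  moreover have "\<exists>!r. r < v ^ t \<and> restrict (A r) C = u"
    if C: "C \<subseteq> {1..s}" "card C = t" "u \<in> C \<rightarrow>\<^sub>E X" for C u
  proof -
    obtain x where x: "x \<in> R" "restrict x C = u"
      and uniq: "\<And>y. y \<in> R \<Longrightarrow> restrict y C = u \<Longrightarrow> y = x"
      using ex1[OF C] by blast
    obtain r where r: "r < v ^ t" "A r = x"
      using A x(1) by (auto simp: bij_betw_def)
    show ?thesis
    proof (intro ex1I[of _ r] conjI)
      fix r' assume r': "r' < v ^ t \<and> restrict (A r') C = u"
      \<comment> \<open>\<open>ex1\<close> only identifies the rows as vectors; injectivity of the
        numbering then identifies their indices.\<close>
      then have "A r' = A r" using uniq[of "A r'"] bij_betwE[OF A] r(2) by auto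
      then show "r' = r" using A r' r(1) by (auto simp: bij_betw_def inj_on_def)
    qed (use r x(2) in auto)
  qed
  ultimately have "is_OA t s v A"
    unfolding is_OA_def using assms(1,2) by (intro exI[of _ X] conjI allI impI ballI) simp_all
  then show ?thesis by blast
qed

end
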